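(* Let $d\ge 2$, $Y\in\mathcal{M}_{\mathbf r}\subset\mathbb{R}^{n_1\times\cdots\times n_d}$, and let $\{\mathcal I^{\le j},\mathcal I^{>j}\}_{j=1}^{d-1}$ be nested multi-index sets that define interpolatory oblique projectors $P_{\le j},P_{>j}$ at $Y$ (all as in the context). Then the oblique tangent space projector $$P_Y=\sum_{k=1}^{d-1}\bigl(P_{\le k-1}P_{>k}-P_{\le k}P_{>k}\bigr)+P_{\le d-1},\qquad P_{\le 0}=1,$$ has the cross interpolation property: for every $Z\in\mathbb{R}^{n_1\times\cdots\times n_d}$ and every $i_j\in\{1,\dots,n_j\}$, $$[P_YZ]\bigl(\mathcal I^{\le j-1},i_j,\mathcal I^{>j}\bigr)=Z\bigl(\mathcal I^{\le j-1},i_j,\mathcal I^{>j}\bigr),\qquad j=1,2,\dots,d.$$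
   Context: Unfoldings: for $Z\in\mathbb{R}^{n_1\times\cdots\times n_d}$, $\mathbf Z^{\langle k\rangle}\in\mathbb{R}^{(n_1\cdots n_k)\times(n_{k+1}\cdots n_d)}$ is the matrix with rows indexed by $(i_1,\dots,i_k)$ and columns indexed by $(i_{k+1},\dots,i_d)$, both ordered colexicographically. $\mathrm{Ten}_k$ is the inverse operation: $\mathrm{Ten}_k(\mathbf Z^{\langle k\rangle})=Z$. TT-rank and manifold: the TT-rank of $Y$ is $\mathbf r=(1,r_1,\dots,r_{d-1},1)$ with $r_k=\operatorname{rank}\mathbf Y^{\langle k\rangle}$ (so $r_0=r_d=1$), and $\mathcal{M}_{\mathbf r}=\{Y\in\mathbb{R}^{n_1\times\cdots\times n_d}:\text{TT-rank}(Y)=\mathbf r\}$. Orthogonal decompositions: $U_1,\dots,U_{d-1}$ are left-orthogonal TT-cores and $V_2,\dots,V_d$ right-orthogonal TT-cores of $Y$ ($U_k,V_k\in\mathbb{R}^{r_{k-1}\times n_k\times r_k}$, with $U_k(i_k),V_k(i_k)$ the $r_{k-1}\times r_k$ slices; left-orthogonal means the $r_{k-1}n_k\times r_k$ reshaping of $U_k$ has orthonormal columns, right-orthogonal means the $r_{k-1}\times n_kr_k$ reshaping of $V_k$ has orthonormal rows), such that for every $k=1,\dots,d-1$, $Y(i_1,\dots,i_d)=U_1(i_1)\cdots U_k(i_k)\,\mathbf S_k\,V_{k+1}(i_{k+1})\cdots V_d(i_d)$ with $\mathbf S_k\in\mathbb{R}^{r_k\times r_k}$ invertible. The matrices $\mathbf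 U_{\le k}\in\mathbb{R}^{(n_1\cdots n_k)\times r_k}$ and $\mathbf V_{>k}\in\mathbb{R}^{(n_{k+1}\cdots n_d)\times r_k}$ have rows $\mathbf U_{\le k}(i_1\cdots i_k,:)=U_1(i_1)\cdots U_k(i_k)$ and $\mathbf V_{>k}(i_{k+1}\cdots i_d,:)=\bigl(V_{k+1}(i_{k+1})\cdots V_d(i_d)\bigr)^{\top}$; their columns are orthonormal bases of the range and co-range of $\mathbf Y^{\langle k\rangle}$. Index sets: $\mathcal I^{\le k}$ is a set of $r_k$ multi-indices $(i_1,\dots,i_k)$ and $\mathcal I^{>k}$ a set of $r_k$ multi-indices $(i_{k+1},\dots,i_d)$; $I^{\le k},I^{>k}$ denote the corresponding sets of row, respectively column, indices of the $k$-th unfolding. Nested means, for $k=1,\dots,d-1$, $$\mathcal I^{\le k}\subset\mathcal I^{\le k-1}\times\{1,\dots,n_k\},\qquad \mathcal I^{>k}\subset\{1,\dots,n_{k+1}\}\times\mathcal I^{>k+1},$$ where $\mathcal I^{\le 0}$ and $\mathcal I^{>d}$ are trivial (the corresponding argument is simply omitted). For a tensor $Z$, $Z(\mathcal I^{\le j-1},i_j,\mathcal I^{>j})$ denotes the restriction of $Z$ to multi-indices whose first $j-1$ entries form an element of $\mathcal I^{\le j-1}$, whose $j$-th entry is $i_j$, and whose last $d-j$ entries form an element of $\mathcal I^{>j}$; equalities are entrywise. Interpolatory projectors: put $\mathbf X_{\le k}=\mathbf I_{n_1\cdots n_k}(:,I^{\le k})$ and $\mathbf X_{>k}=\mathbf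 I_{n_{k+1}\cdots n_d}(:,I^{>k})$ (selected columns of identity matrices). The index sets "define interpolatory oblique projectors" when $\mathbf X_{\le k}^{\top}\mathbf U_{\le k}=\mathbf U_{\le k}(I^{\le k},:)$ and $\mathbf X_{>k}^{\top}\mathbf V_{>k}=\mathbf V_{>k}(I^{>k},:)$ are invertible for all $k=1,\dots,d-1$. Then $\mathbf P_{\le k}=\mathbf U_{\le k}(\mathbf X_{\le k}^{\top}\mathbf U_{\le k})^{-1}\mathbf X_{\le k}^{\top}$, $\mathbf P_{>k}=\mathbf X_{>k}(\mathbf X_{>k}^{\top}\mathbf V_{>k})^{-\top}\mathbf V_{>k}^{\top}$, and on tensors $P_{\le k}Z=\mathrm{Ten}_k[\mathbf P_{\le k}\mathbf Z^{\langle k\rangle}]$, $P_{>k}Z=\mathrm{Ten}_k[\mathbf Z^{\langle k\rangle}\mathbf P_{>k}]$. *)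

theory Defs
  imports
    "Jordan_Normal_Form.DL_Rank"
    "Jordan_Normal_Form.DL_Submatrix"
    "Jordan_Normal_Form.Gauss_Jordan_Elimination"
begin

section \<open>Multi-indices and tensors\<close>

text \<open>
  Modes are numbered \<open>1, \<dots>, d\<close> and mode \<open>k\<close> has size \<open>n k\<close>, but the index of
  each mode runs through \<open>{0..<n k}\<close>, as matrix indices do. The set
  \<open>multi_indices n a b\<close> consists of the multi-indices \<open>(i\<^sub>a\<^sub>+\<^sub>1, \<dots>, i\<^sub>b)\<close>.
\<close>

definition multi_indices :: "(nat \<Rightarrow> nat) \<Rightarrow> nat \<Rightarrow> nat \<Rightarrow> nat list set" where
  "multi_indices n a b =
     {is. length is = b - a \<and> (\<forall>t < b - a. is ! t < n (a + t + 1))}"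

definition num_indices :: "(nat \<Rightarrow> nat) \<Rightarrow> nat \<Rightarrow> nat \<Rightarrow> nat" where
  "num_indices n a b = (\<Prod>k = a + 1..b. n k)"

text \<open>
  The colexicographic position
  \<open>i\<^sub>a\<^sub>+\<^sub>1 + n\<^sub>a\<^sub>+\<^sub>1 (i\<^sub>a\<^sub>+\<^sub>2 + n\<^sub>a\<^sub>+\<^sub>2 (\<dots>))\<close>: the first entry varies fastest.
\<close>

primrec colex :: "(nat \<Rightarrow> nat) \<Rightarrow> nat \<Rightarrow> nat list \<Rightarrow> nat" where
  "colex n a [] = 0"
| "colex n a (i # is) = i + n (a + 1) * colex n (a + 1) is"

definition colex_inv :: "(nat \<Rightarrow> nat) \<Rightarrow> nat \<Rightarrow> nat \<Rightarrow> nat \<Rightarrow> nat list" where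
  "colex_inv n a b = the_inv_into (multi_indices n a b) (colex n a)"

lemma Nil_multi_indices: "multi_indices n a a = {[]}"
  by (auto simp: multi_indices_def)

lemma Cons_multi_indices:
  assumes "a < b"
  shows "i # is \<in> multi_indices n a b \<longleftrightarrow> i < n (a + 1) \<and> is \<in> multi_indices n (a + 1) b"
proof -
  obtain c where b: "b = Suc (a + c)"
    using assms less_iff_Suc_add by auto
  show ?thesis
    by (auto simp: multi_indices_def b nth_Cons' less_Suc_eq_0_disj)
qed

lemma num_indices_step: "a < b \<Longrightarrow> num_indices n a b = n (a + 1) * num_indices n (a + 1) b"
  by (simp add: num_indices_def prod.atLeast_Suc_atMost)

lemma bij_betw_colex:
  assumes "a \<le> b"
  shows "bij_betw (colex n a) (multi_indices n a b) {..<num_indices n a b}"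
  using assms
proof (induction a rule: inc_induct)
  case base
  show ?case
    by (simp add: Nil_multi_indices num_indices_def bij_betw_def lessThan_Suc)
next
  case (step a)
  let ?m = "n (a + 1)" and ?N = "num_indices n (a + 1) b"
  have IH: "bij_betw (colex n (a + 1)) (multi_indices n (a + 1) b) {..<?N}"
    using step.IH by simp
  have split: "\<exists>i is. xs = i # is \<and> i < ?m \<and> is \<in> multi_indices n (a + 1) b"
    if "xs \<in> multi_indices n a b" for xs
    using that step.hyps Cons_multi_indices[of a b]
    by (cases xs) (auto simp: multi_indices_def)
  have dig: "(i + ?m * p) mod ?m = i" "(i + ?m * p) div ?m = p" if "i < ?m" for i p
    using that by auto
  have inj: "inj_on (colex n a) (multi_indices n a b)"
  proof (rule inj_onI)
    fix xs ys
    assume xs: "xs \<in> multi_indices n a b" and ys: "ys \<in> multi_indices n a b"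
      and eq: "colex n a xs = colex n a ys"
    obtain i p where 1: "xs = i # p" "i < ?m" "p \<in> multi_indices n (a + 1) b"
      using split[OF xs] by blast
    obtain j q where 2: "ys = j # q" "j < ?m" "q \<in> multi_indices n (a + 1) b"
      using split[OF ys] by blast
    have eq': "i + ?m * colex n (a + 1) p = j + ?m * colex n (a + 1) q"
      using eq 1 2 by simp
    have "i = j" "colex n (a + 1) p = colex n (a + 1) q"
      using dig[OF 1(2)] dig[OF 2(2)] eq' by metis+
    then show "xs = ys"
      using 1 2 IH by (auto simp: bij_betw_def dest: inj_onD)
  qed
  have "colex n a ` multi_indices n a b = {..<?m * ?N}"
  proof (intro equalityI subsetI)
    fix p assume "p \<in> colex n a ` multi_indices n a b"
    then obtain i "is" where 1: "p = i + ?m * colex n (a + 1) is" "i < ?m"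
        "is \<in> multi_indices n (a + 1) b"
      using split by fastforce
    have "colex n (a + 1) is < ?N"
      using IH 1(3) by (auto simp: bij_betw_def)
    then have "?m * Suc (colex n (a + 1) is) \<le> ?m * ?N"
      by (intro mult_le_mono2) simp
    then show "p \<in> {..<?m * ?N}"
      using 1 by simp
  next
    fix p assume p: "p \<in> {..<?m * ?N}"
    then have m: "?m > 0" by (cases "?m = 0") auto
    have "p div ?m < ?N"
      using p by (simp add: less_mult_imp_div_less mult.commute)
    then obtain "is" where 1: "is \<in> multi_indices n (a + 1) b" "colex n (a + 1) is = p div ?m"
      using IH unfolding bij_betw_def by (metis imageE lessThan_iff)
    have "(p mod ?m) # is \<in> multi_indices n a b"
      using 1 m Cons_multi_indices step.hyps by simp
    moreover have "colex n a ((p mod ?m) # is) = p"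
      using 1 by simp
    ultimately show "p \<in> colex n a ` multi_indices n a b"
      by (metis imageI)
  qed
  then show ?case
    using inj step.hyps by (simp add: bij_betw_def num_indices_step)
qed

text \<open>A tensor is represented by its entries, extended by zero to all lists.\<close>

definition tensors :: "nat \<Rightarrow> (nat \<Rightarrow> nat) \<Rightarrow> (nat list \<Rightarrow> real) set" where
  "tensors d n = {Z. \<forall>is. is \<notin> multi_indices n 0 d \<longrightarrow> Z is = 0}"

definition unfolding_mat ::
    "nat \<Rightarrow> (nat \<Rightarrow> nat) \<Rightarrow> nat \<Rightarrow> (nat list \<Rightarrow> real) \<Rightarrow> real mat" where
  "unfolding_mat d n k Z = mat (num_indices n 0 k) (num_indices n k d)
     (\<lambda>(p, q). Z (colex_inv n 0 k p @ colex_inv n k d q))"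

definition Ten :: "nat \<Rightarrow> (nat \<Rightarrow> nat) \<Rightarrow> nat \<Rightarrow> real mat \<Rightarrow> nat list \<Rightarrow> real" where
  "Ten d n k M = (\<lambda>is. if is \<in> multi_indices n 0 d
     then M $$ (colex n 0 (take k is), colex n k (drop k is)) else 0)"

lemma Ten_unfolding_mat:
  assumes "Z \<in> tensors d n" and "k \<le> d"
  shows "Ten d n k (unfolding_mat d n k Z) = Z"
proof
  fix xs
  show "Ten d n k (unfolding_mat d n k Z) xs = Z xs"
  proof (cases "xs \<in> multi_indices n 0 d")
    case False
    then show ?thesis using assms(1) by (auto simp: Ten_def tensors_def)
  next
    case True
    have l: "take k xs \<in> multi_indices n 0 k" and g: "drop k xs \<in> multi_indices n k d"
      using True assms(2) by (auto simp: multi_indices_def)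
    have bl: "bij_betw (colex n 0) (multi_indices n 0 k) {..<num_indices n 0 k}"
      and bg: "bij_betw (colex n k) (multi_indices n k d) {..<num_indices n k d}"
      using bij_betw_colex assms(2) by simp_all
    have "colex_inv n 0 k (colex n 0 (take k xs)) = take k xs"
      "colex_inv n k d (colex n k (drop k xs)) = drop k xs"
      using bl bg l g by (auto simp: colex_inv_def bij_betw_def the_inv_into_f_f)
    moreover have "colex n 0 (take k xs) < num_indices n 0 k"
      "colex n k (drop k xs) < num_indices n k d"
      using bl bg l g by (auto simp: bij_betw_def)
    ultimately show ?thesis
      using True by (simp add: Ten_def unfolding_mat_def)
  qed
qed


section \<open>TT-rank and orthogonal TT-decompositions\<close>

definition tt_rank :: "nat \<Rightarrow> (nat \<Rightarrow> nat) \<Rightarrow> (nat list \<Rightarrow> real) \<Rightarrow> nat \<Rightarrow> nat" where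
  "tt_rank d n Y k = (if k = 0 \<or> k = d then 1
     else vec_space.rank (num_indices n 0 k) (unfolding_mat d n k Y))"

definition tt_manifold ::
    "nat \<Rightarrow> (nat \<Rightarrow> nat) \<Rightarrow> (nat \<Rightarrow> nat) \<Rightarrow> (nat list \<Rightarrow> real) set" where
  "tt_manifold d n r = {Y \<in> tensors d n. \<forall>k \<le> d. tt_rank d n Y k = r k}"

text \<open>
  A family of TT-cores is given by its slices: \<open>G k i\<close> is the
  \<open>r (k - 1) \<times> r k\<close> matrix \<open>G\<^sub>k(i)\<close>.
\<close>

type_synonym cores = "nat \<Rightarrow> nat \<Rightarrow> real mat"

definition is_core :: "(nat \<Rightarrow> nat) \<Rightarrow> (nat \<Rightarrow> nat) \<Rightarrow> cores \<Rightarrow> nat \<Rightarrow> bool" where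
  "is_core n r G k \<longleftrightarrow> (\<forall>i < n k. G k i \<in> carrier_mat (r (k - 1)) (r k))"

definition left_reshape :: "(nat \<Rightarrow> nat) \<Rightarrow> (nat \<Rightarrow> nat) \<Rightarrow> cores \<Rightarrow> nat \<Rightarrow> real mat" where
  "left_reshape n r G k = mat (r (k - 1) * n k) (r k)
     (\<lambda>(p, \<beta>). G k (p div r (k - 1)) $$ (p mod r (k - 1), \<beta>))"

definition right_reshape :: "(nat \<Rightarrow> nat) \<Rightarrow> (nat \<Rightarrow> nat) \<Rightarrow> cores \<Rightarrow> nat \<Rightarrow> real mat" where
  "right_reshape n r G k = mat (r (k - 1)) (n k * r k)
     (\<lambda>(\<alpha>, q). G k (q mod n k) $$ (\<alpha>, q div n k))"

definition left_orthogonal :: "(nat \<Rightarrow> nat) \<Rightarrow> (nat \<Rightarrow> nat) \<Rightarrow> cores \<Rightarrow> nat \<Rightarrow> bool" where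
  "left_orthogonal n r G k \<longleftrightarrow>
     transpose_mat (left_reshape n r G k) * left_reshape n r G k = 1\<^sub>m (r k)"

definition right_orthogonal :: "(nat \<Rightarrow> nat) \<Rightarrow> (nat \<Rightarrow> nat) \<Rightarrow> cores \<Rightarrow> nat \<Rightarrow> bool" where
  "right_orthogonal n r G k \<longleftrightarrow>
     right_reshape n r G k * transpose_mat (right_reshape n r G k) = 1\<^sub>m (r (k - 1))"

text \<open>\<open>slice_prod r G a [i\<^sub>a\<^sub>+\<^sub>1, \<dots>, i\<^sub>b]\<close> is \<open>G\<^sub>a\<^sub>+\<^sub>1(i\<^sub>a\<^sub>+\<^sub>1) \<cdots> G\<^sub>b(i\<^sub>b)\<close>.\<close>

primrec slice_prod :: "(nat \<Rightarrow> nat) \<Rightarrow> cores \<Rightarrow> nat \<Rightarrow> nat list \<Rightarrow> real mat" where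
  "slice_prod r G a [] = 1\<^sub>m (r a)"
| "slice_prod r G a (i # is) = G (a + 1) i * slice_prod r G (a + 1) is"

definition orthogonal_decompositions ::
    "nat \<Rightarrow> (nat \<Rightarrow> nat) \<Rightarrow> (nat \<Rightarrow> nat) \<Rightarrow> (nat list \<Rightarrow> real)
      \<Rightarrow> cores \<Rightarrow> (nat \<Rightarrow> real mat) \<Rightarrow> cores \<Rightarrow> bool" where
  "orthogonal_decompositions d n r Y U S V \<longleftrightarrow>
     (\<forall>k \<in> {1..d - 1}. is_core n r U k \<and> left_orthogonal n r U k) \<and>
     (\<forall>k \<in> {2..d}. is_core n r V k \<and> right_orthogonal n r V k) \<and>
     (\<forall>k \<in> {1..d - 1}.
        S k \<in> carrier_mat (r k) (r k) \<and> invertible_mat (S k) \<and>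
        (\<forall>is \<in> multi_indices n 0 d.
           Y is = (slice_prod r U 0 (take k is) * S k * slice_prod r V k (drop k is)) $$ (0, 0)))"

definition U_le :: "(nat \<Rightarrow> nat) \<Rightarrow> (nat \<Rightarrow> nat) \<Rightarrow> cores \<Rightarrow> nat \<Rightarrow> real mat" where
  "U_le n r U k = mat (num_indices n 0 k) (r k)
     (\<lambda>(p, \<alpha>). slice_prod r U 0 (colex_inv n 0 k p) $$ (0, \<alpha>))"

definition V_gt :: "nat \<Rightarrow> (nat \<Rightarrow> nat) \<Rightarrow> (nat \<Rightarrow> nat) \<Rightarrow> cores \<Rightarrow> nat \<Rightarrow> real mat" where
  "V_gt d n r V k = mat (num_indices n k d) (r k)
     (\<lambda>(q, \<alpha>). slice_prod r V k (colex_inv n k d q) $$ (\<alpha>, 0))"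


section \<open>Nested index sets\<close>

text \<open>
  The trivial sets \<open>\<I>\<^sup>\<le>\<^sup>0\<close> and \<open>\<I>\<^sup>>\<^sup>d\<close> are represented by the singleton of the
  empty multi-index.
\<close>

definition index_sets ::
    "nat \<Rightarrow> (nat \<Rightarrow> nat) \<Rightarrow> (nat \<Rightarrow> nat) \<Rightarrow> (nat \<Rightarrow> nat list set) \<Rightarrow> (nat \<Rightarrow> nat list set) \<Rightarrow> bool" where
  "index_sets d n r Ile Igt \<longleftrightarrow>
     Ile 0 = {[]} \<and> Igt d = {[]} \<and>
     (\<forall>k \<in> {1..d - 1}.
        Ile k \<subseteq> multi_indices n 0 k \<and> card (Ile k) = r k \<and>
        Igt k \<subseteq> multi_indices n k d \<and> card (Igt k) = r k)"

definition nested ::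
    "nat \<Rightarrow> (nat \<Rightarrow> nat) \<Rightarrow> (nat \<Rightarrow> nat list set) \<Rightarrow> (nat \<Rightarrow> nat list set) \<Rightarrow> bool" where
  "nested d n Ile Igt \<longleftrightarrow>
     (\<forall>k \<in> {1..d - 1}.
        Ile k \<subseteq> {is @ [i] | is i. is \<in> Ile (k - 1) \<and> i < n k} \<and>
        Igt k \<subseteq> {i # is | i is. i < n (k + 1) \<and> is \<in> Igt (k + 1)})"


section \<open>Interpolatory oblique projectors\<close>

text \<open>
  The selected columns of the identity are listed in increasing order of their
  index.
\<close>

definition X_le :: "(nat \<Rightarrow> nat) \<Rightarrow> (nat \<Rightarrow> nat list set) \<Rightarrow> nat \<Rightarrow> real mat" where
  "X_le n Ile k = submatrix (1\<^sub>m (num_indices n 0 k)) UNIV (colex n 0 ` Ile k)"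

definition X_gt :: "nat \<Rightarrow> (nat \<Rightarrow> nat) \<Rightarrow> (nat \<Rightarrow> nat list set) \<Rightarrow> nat \<Rightarrow> real mat" where
  "X_gt d n Igt k = submatrix (1\<^sub>m (num_indices n k d)) UNIV (colex n k ` Igt k)"

definition define_interpolatory_projectors ::
    "nat \<Rightarrow> (nat \<Rightarrow> nat) \<Rightarrow> (nat \<Rightarrow> nat) \<Rightarrow> cores \<Rightarrow> cores
      \<Rightarrow> (nat \<Rightarrow> nat list set) \<Rightarrow> (nat \<Rightarrow> nat list set) \<Rightarrow> bool" where
  "define_interpolatory_projectors d n r U V Ile Igt \<longleftrightarrow>
     (\<forall>k \<in> {1..d - 1}.
        invertible_mat (transpose_mat (X_le n Ile k) * U_le n r U k) \<and>
        invertible_mat (transpose_mat (X_gt d n Igt k) * V_gt d n r V k))"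

definition inv_mat :: "real mat \<Rightarrow> real mat" where
  "inv_mat A = the (mat_inverse A)"

definition P_le_mat ::
    "(nat \<Rightarrow> nat) \<Rightarrow> (nat \<Rightarrow> nat) \<Rightarrow> cores \<Rightarrow> (nat \<Rightarrow> nat list set) \<Rightarrow> nat \<Rightarrow> real mat" where
  "P_le_mat n r U Ile k =
     U_le n r U k * inv_mat (transpose_mat (X_le n Ile k) * U_le n r U k)
       * transpose_mat (X_le n Ile k)"

definition P_gt_mat ::
    "nat \<Rightarrow> (nat \<Rightarrow> nat) \<Rightarrow> (nat \<Rightarrow> nat) \<Rightarrow> cores \<Rightarrow> (nat \<Rightarrow> nat list set) \<Rightarrow> nat \<Rightarrow> real mat" where
  "P_gt_mat d n r V Igt k =
     X_gt d n Igt k * transpose_mat (inv_mat (transpose_mat (X_gt d n Igt k) * V_gt d n r V k))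
       * transpose_mat (V_gt d n r V k)"

definition P_le ::
    "nat \<Rightarrow> (nat \<Rightarrow> nat) \<Rightarrow> (nat \<Rightarrow> nat) \<Rightarrow> cores \<Rightarrow> (nat \<Rightarrow> nat list set) \<Rightarrow> nat
      \<Rightarrow> (nat list \<Rightarrow> real) \<Rightarrow> nat list \<Rightarrow> real" where
  "P_le d n r U Ile k Z =
     (if k = 0 then Z else Ten d n k (P_le_mat n r U Ile k * unfolding_mat d n k Z))"

definition P_gt ::
    "nat \<Rightarrow> (nat \<Rightarrow> nat) \<Rightarrow> (nat \<Rightarrow> nat) \<Rightarrow> cores \<Rightarrow> (nat \<Rightarrow> nat list set) \<Rightarrow> nat
      \<Rightarrow> (nat list \<Rightarrow> real) \<Rightarrow> nat list \<Rightarrow> real" where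
  "P_gt d n r V Igt k Z = Ten d n k (unfolding_mat d n k Z * P_gt_mat d n r V Igt k)"

definition tangent_projector ::
    "nat \<Rightarrow> (nat \<Rightarrow> nat) \<Rightarrow> (nat \<Rightarrow> nat) \<Rightarrow> cores \<Rightarrow> cores
      \<Rightarrow> (nat \<Rightarrow> nat list set) \<Rightarrow> (nat \<Rightarrow> nat list set)
      \<Rightarrow> (nat list \<Rightarrow> real) \<Rightarrow> nat list \<Rightarrow> real" where
  "tangent_projector d n r U V Ile Igt Z = (\<lambda>is.
     (\<Sum>k = 1..d - 1.
        P_le d n r U Ile (k - 1) (P_gt d n r V Igt k Z) is
        - P_le d n r U Ile k (P_gt d n r V Igt k Z) is)
     + P_le d n r U Ile (d - 1) Z is)"

end

theory Submission
  imports Defs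
begin

text \<open>
  On the evaluated entries, \<open>P\<^bsub>\<le>k\<^esub>\<close> acts as the identity for \<open>k < j\<close> and
  \<open>P\<^bsub>>k\<^esub>\<close> acts as the identity for \<open>k \<ge> j\<close>, because an oblique projector
  interpolates on its index set and the index sets are nested. For \<open>k < j\<close> both
  differences \<open>P\<^bsub>\<le>k-1\<^esub>P\<^bsub>>k\<^esub>Z - P\<^bsub>\<le>k\<^esub>P\<^bsub>>k\<^esub>Z\<close> and \<open>P\<^bsub>\<le>k-1\<^esub>Z - P\<^bsub>\<le>k\<^esub>Z\<close> vanish there. For
  \<open>k \<ge> j\<close> they agree, since \<open>P\<^bsub>\<le>k-1\<^esub>\<close> and \<open>P\<^bsub>\<le>k\<^esub>\<close> only combine entries with the same
  last \<open>d - k\<close> indices. So \<open>P\<^bsub>>k\<^esub>\<close> can be dropped and the sum telescopes to \<open>Z\<close>.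
\<close>

section \<open>Matrix inverses, column selections and oblique projectors\<close>

text \<open>\<open>inv_mat\<close> is \<open>the\<close> of an option. Invertibility makes
  \<open>A\<close> a unit of the matrix ring, which rules out \<open>None\<close> as the result of
  \<open>mat_inverse\<close>.\<close>

lemma inv_mat_right:
  assumes "invertible_mat A" and A: "A \<in> carrier_mat m m"
  shows "inv_mat A \<in> carrier_mat m m" "A * inv_mat A = 1\<^sub>m m"
proof -
  have "A \<in> Units (ring_mat TYPE(real) m ())"
  proof -
    obtain B where B: "A * B = 1\<^sub>m m" "B * A = 1\<^sub>m (dim_row B)"
      using assms unfolding invertible_mat_def inverts_mat_def by auto
    \<comment> \<open>\<open>invertible_mat\<close> does not fix the size of \<open>B\<close>; it is
      read off from the two product equations.\<close>
    have "dim_row B = m" "dim_col B = m"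
      using B A by (metis carrier_matD(2) index_mult_mat(2,3) index_one_mat(2,3))+
    then show ?thesis
      using A B unfolding Units_def ring_mat_def by auto
  qed
  then obtain B where B: "mat_inverse A = Some B"
    using mat_inverse(1)[OF A, where b = "()"] by (cases "mat_inverse A") auto
  show "inv_mat A \<in> carrier_mat m m" "A * inv_mat A = 1\<^sub>m m"
    using mat_inverse(2)[OF A B] B by (auto simp: inv_mat_def)
qed

text \<open>The left-hand side is the form in which \<open>dim_submatrix\<close> expresses
  dimensions.\<close>

lemma card_restrict:
  assumes "I \<subseteq> {..<N}"
  shows "card {i. i < (N::nat) \<and> i \<in> I} = card I"
  using assms by (intro arg_cong[where f = card]) auto

lemma column_selection_carrier:
  assumes "I \<subseteq> {..<N}"
  shows "submatrix (1\<^sub>m N) UNIV I \<in> carrier_mat N (card I)"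
  using card_restrict[OF assms] by (intro carrier_matI) (simp_all add: dim_submatrix)

text \<open>Column \<open>t\<close> of the selection matrix is the unit vector at
  \<open>pick I t\<close>, so multiplying by the transpose extracts the selected rows.\<close>

lemma index_transpose_selection_mult:
  fixes A :: "'a :: comm_semiring_1 mat"
  assumes I: "I \<subseteq> {..<N}" and A: "A \<in> carrier_mat N m"
    and t: "t < card I" and q: "q < m"
  shows "(transpose_mat (submatrix (1\<^sub>m N) UNIV I) * A) $$ (t, q) = A $$ (pick I t, q)"
proof -
  let ?X = "submatrix (1\<^sub>m N) UNIV I :: 'a mat"
  note X = column_selection_carrier[OF I, where ?'a = 'a]
  have p: "pick I t < N"
    using pick_in_set_le[OF t] I by auto
  have entry: "?X $$ (s, t) = (if s = pick I t then 1 else 0)" if "s < N" for s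
    using that p t card_restrict[OF I] by (simp add: submatrix_index pick_UNIV)
  have "(transpose_mat ?X * A) $$ (t, q) = (\<Sum>s = 0..<N. ?X $$ (s, t) * A $$ (s, q))"
    using X A t q by (simp add: scalar_prod_def)
  also have "\<dots> = (\<Sum>s = 0..<N. if s = pick I t then A $$ (s, q) else 0)"
    by (intro sum.cong refl) (auto simp: entry)
  also have "\<dots> = A $$ (pick I t, q)"
    using p by simp
  finally show ?thesis .
qed

text \<open>With \<open>P = A (X\<^sup>T A)\<^sup>-\<^sup>1 X\<^sup>T\<close> one has \<open>X\<^sup>T P = X\<^sup>T\<close>.\<close>

lemma oblique_projector_row:
  fixes A :: "real mat"
  assumes I: "I \<subseteq> {..<N}" and A: "A \<in> carrier_mat N (card I)"
    and X: "X = submatrix (1\<^sub>m N) UNIV I"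
    and inv: "invertible_mat (transpose_mat X * A)"
    and p: "p \<in> I" and q: "q < N"
  shows "(A * inv_mat (transpose_mat X * A) * transpose_mat X) $$ (p, q) = (if p = q then 1 else 0)"
proof -
  let ?B = "inv_mat (transpose_mat X * A)"
  have Xc: "X \<in> carrier_mat N (card I)"
    unfolding X by (rule column_selection_carrier[OF I])
  then have Xt: "transpose_mat X \<in> carrier_mat (card I) N"
    by simp
  have XA: "transpose_mat X * A \<in> carrier_mat (card I) (card I)"
    using Xc A by auto
  note B = inv_mat_right[OF inv XA]
  let ?P = "A * ?B * transpose_mat X"
  have P: "?P \<in> carrier_mat N N"
    using A B Xc by auto
  have "transpose_mat X * ?P = (transpose_mat X * A) * ?B * transpose_mat X"
    using assoc_mult_mat[OF Xt A B(1)] assoc_mult_mat[OF Xt mult_carrier_mat[OF A B(1)] Xt]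
    by simp
  \<comment> \<open>The identity factor is kept so that row extraction applies to both sides of the
    equation.\<close>
  also have "\<dots> = transpose_mat X * 1\<^sub>m N"
    using B(2) Xt by simp
  finally have eq: "transpose_mat X * ?P = transpose_mat X * 1\<^sub>m N" .
  have "finite I"
    using I finite_subset by blast
  moreover have "{a \<in> I. a < p} \<subset> I"
    using p by auto
  \<comment> \<open>\<open>t\<close> is the number of elements of \<open>I\<close> below
    \<open>p\<close>; since \<open>p\<close> itself is not counted, \<open>t\<close> is less than
    \<open>card I\<close>.\<close>
  ultimately obtain t where t: "t < card I" "pick I t = p"
    using pick_card_in_set[OF p] psubset_card_mono by blast
  have pN: "p < N"
    using p I by auto
  have "?P $$ (p, q) = (transpose_mat X * ?P) $$ (t, q)"
    using index_transpose_selection_mult[OF I P t(1) q] t(2) X by simp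
  also have "\<dots> = (1\<^sub>m N :: real mat) $$ (p, q)"
    unfolding eq using index_transpose_selection_mult[OF I one_carrier_mat t(1) q] t(2) X by simp
  finally show ?thesis
    using pN q by simp
qed

section \<open>Multi-indices and their colexicographic positions\<close>

lemma colex_less:
  "a \<le> b \<Longrightarrow> is \<in> multi_indices n a b \<Longrightarrow> colex n a is < num_indices n a b"
  using bij_betw_colex[of a b n] by (auto simp: bij_betw_def)

lemma colex_inv_colex:
  "a \<le> b \<Longrightarrow> is \<in> multi_indices n a b \<Longrightarrow> colex_inv n a b (colex n a is) = is"
  using bij_betw_colex[of a b n] by (simp add: colex_inv_def bij_betw_def the_inv_into_f_f)

lemma colex_inv_in_multi_indices:
  "a \<le> b \<Longrightarrow> p < num_indices n a b \<Longrightarrow> colex_inv n a b p \<in> multi_indices n a b"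
  unfolding colex_inv_def
  using bij_betw_apply[OF bij_betw_the_inv_into[OF bij_betw_colex]] by simp

lemma card_colex_image:
  assumes "a \<le> b" and "I \<subseteq> multi_indices n a b"
  shows "card (colex n a ` I) = card I"
  using bij_betw_imp_inj_on[OF bij_betw_colex[OF assms(1)]] assms(2)
  by (metis card_image inj_on_subset)

lemma append_multi_indices:
  assumes "a \<le> b" "b \<le> c" and "xs \<in> multi_indices n a b" "ys \<in> multi_indices n b c"
  shows "xs @ ys \<in> multi_indices n a c"
proof -
  have "(xs @ ys) ! t < n (a + t + 1)" if "t < c - a" for t
  proof (cases "t < b - a")
    case True
    then show ?thesis
      using assms by (simp add: multi_indices_def nth_append)
  next
    case False
    then obtain s where s: "t = b - a + s"
      by (metis le_iff_add not_less)
    then have "s < c - b" "a + t = b + s"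
      using that assms(1) by auto
    moreover have "(xs @ ys) ! t = ys ! s"
      using assms(3) s by (simp add: multi_indices_def nth_append)
    ultimately show ?thesis
      using assms(4) by (simp add: multi_indices_def)
  qed
  then show ?thesis
    using assms by (auto simp: multi_indices_def)
qed

lemma take_drop_multi_indices:
  assumes "xs \<in> multi_indices n 0 d" "k \<le> d"
  shows "take k xs \<in> multi_indices n 0 k" "drop k xs \<in> multi_indices n k d"
  using assms by (auto simp: multi_indices_def)

section \<open>Entries of matrix products with unfoldings\<close>

text \<open>Left multiplication mixes only entries that share the last \<open>d - k\<close> indices;
  the sum makes this explicit.\<close>

lemma Ten_left_mult:
  assumes "k \<le> d" and xs: "xs \<in> multi_indices n 0 d"
    and P: "P \<in> carrier_mat (num_indices n 0 k) (num_indices n 0 k)"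
  shows "Ten d n k (P * unfolding_mat d n k Z) xs =
    (\<Sum>p<num_indices n 0 k. P $$ (colex n 0 (take k xs), p) * Z (colex_inv n 0 k p @ drop k xs))"
  using assms take_drop_multi_indices[OF xs \<open>k \<le> d\<close>]
  by (simp add: Ten_def unfolding_mat_def scalar_prod_def colex_less colex_inv_colex
      lessThan_atLeast0)

lemma Ten_right_mult:
  assumes "k \<le> d" and xs: "xs \<in> multi_indices n 0 d"
    and P: "P \<in> carrier_mat (num_indices n k d) (num_indices n k d)"
  shows "Ten d n k (unfolding_mat d n k Z * P) xs =
    (\<Sum>q<num_indices n k d. Z (take k xs @ colex_inv n k d q) * P $$ (q, colex n k (drop k xs)))"
  using assms take_drop_multi_indices[OF xs \<open>k \<le> d\<close>]
  by (simp add: Ten_def unfolding_mat_def scalar_prod_def colex_less colex_inv_colex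
      lessThan_atLeast0)

section \<open>Interpolatory projectors acting on tensors\<close>

locale interpolatory_projectors =
  fixes d :: nat and n r :: "nat \<Rightarrow> nat" and U V :: cores
    and Ile Igt :: "nat \<Rightarrow> nat list set"
  assumes index_sets: "index_sets d n r Ile Igt"
    and nested: "nested d n Ile Igt"
    and projectors: "define_interpolatory_projectors d n r U V Ile Igt"
begin

lemma Ile_subset: "k < d \<Longrightarrow> Ile k \<subseteq> multi_indices n 0 k"
  using index_sets by (cases "k = 0") (auto simp: index_sets_def Nil_multi_indices)

lemma length_Ile: "k < d \<Longrightarrow> is \<in> Ile k \<Longrightarrow> length is = k"
  using Ile_subset[of k] by (auto simp: multi_indices_def)

lemma Igt_subset: "1 \<le> k \<Longrightarrow> k \<le> d \<Longrightarrow> Igt k \<subseteq> multi_indices n k d"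
  using index_sets by (cases "k = d") (auto simp: index_sets_def Nil_multi_indices)

lemma colex_Ile:
  assumes "k \<in> {1..d - 1}"
  shows "colex n 0 ` Ile k \<subseteq> {..<num_indices n 0 k}" "card (colex n 0 ` Ile k) = r k"
proof -
  have "Ile k \<subseteq> multi_indices n 0 k" "card (Ile k) = r k"
    using assms index_sets by (auto simp: index_sets_def)
  then show "colex n 0 ` Ile k \<subseteq> {..<num_indices n 0 k}" "card (colex n 0 ` Ile k) = r k"
    using colex_less[of 0 k] card_colex_image[of 0 k] by auto
qed

lemma colex_Igt:
  assumes "k \<in> {1..d - 1}"
  shows "colex n k ` Igt k \<subseteq> {..<num_indices n k d}" "card (colex n k ` Igt k) = r k"
proof -
  have "Igt k \<subseteq> multi_indices n k d" "card (Igt k) = r k" "k \<le> d"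
    using assms index_sets by (auto simp: index_sets_def)
  then show "colex n k ` Igt k \<subseteq> {..<num_indices n k d}" "card (colex n k ` Igt k) = r k"
    using colex_less[of k d] card_colex_image[of k d] by auto
qed

lemma P_le_mat_carrier:
  assumes "k \<in> {1..d - 1}"
  shows "P_le_mat n r U Ile k \<in> carrier_mat (num_indices n 0 k) (num_indices n 0 k)"
  using carrier_matD(1)[OF column_selection_carrier[OF colex_Ile(1)[OF assms]]]
  by (intro carrier_matI) (simp_all add: P_le_mat_def U_le_def X_le_def)

lemma P_gt_mat_carrier:
  assumes "k \<in> {1..d - 1}"
  shows "P_gt_mat d n r V Igt k \<in> carrier_mat (num_indices n k d) (num_indices n k d)"
  using carrier_matD(1)[OF column_selection_carrier[OF colex_Igt(1)[OF assms]]]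
  by (intro carrier_matI) (simp_all add: P_gt_mat_def V_gt_def X_gt_def)

text \<open>Only the first \<open>k\<close> indices are summed over, so the values of
  \<open>W\<close> on other tails cannot matter. This allows rewriting under \<open>P_le\<close>
  even when the prefix of \<open>xs\<close> is not selected.\<close>

lemma P_le_cong:
  assumes k: "k < d" and xs: "xs \<in> multi_indices n 0 d"
    and eq: "\<And>ys. ys \<in> multi_indices n 0 k \<Longrightarrow> W (ys @ drop k xs) = W' (ys @ drop k xs)"
  shows "P_le d n r U Ile k W xs = P_le d n r U Ile k W' xs"
proof (cases "k = 0")
  case True
  then show ?thesis
    using eq[of "[]"] by (simp add: P_le_def Nil_multi_indices)
next
  case False
  then have "k \<in> {1..d - 1}"
    using k by auto
  then show ?thesis
    using False k eq colex_inv_in_multi_indices[of 0 k]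
    by (simp add: P_le_def Ten_left_mult[OF _ xs P_le_mat_carrier])
qed

text \<open>A selected row of the projector matrix is a unit row, which collapses the sum to one
  term. For \<open>k = 0\<close> the projector is the identity by definition.\<close>

lemma P_le_interpolation:
  assumes k: "k < d" and xs: "xs \<in> multi_indices n 0 d" and mem: "take k xs \<in> Ile k"
  shows "P_le d n r U Ile k W xs = W xs"
proof (cases "k = 0")
  case True
  then show ?thesis
    by (simp add: P_le_def)
next
  case False
  then have k': "k \<in> {1..d - 1}"
    using k by auto
  let ?p = "colex n 0 (take k xs)"
  have tk: "take k xs \<in> multi_indices n 0 k"
    using take_drop_multi_indices xs k by simp
  have inv: "invertible_mat (transpose_mat (X_le n Ile k) * U_le n r U k)"
    using projectors k' by (simp add: define_interpolatory_projectors_def)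
  have row: "P_le_mat n r U Ile k $$ (?p, q) = (if ?p = q then 1 else 0)"
    if "q < num_indices n 0 k" for q
    unfolding P_le_mat_def
    by (rule oblique_projector_row[OF colex_Ile(1)[OF k'] _ X_le_def inv])
      (use that mem colex_Ile(2)[OF k'] in \<open>simp_all add: U_le_def\<close>)
  have "P_le d n r U Ile k W xs =
      (\<Sum>p<num_indices n 0 k.
        P_le_mat n r U Ile k $$ (?p, p) * W (colex_inv n 0 k p @ drop k xs))"
    using False k Ten_left_mult[OF _ xs P_le_mat_carrier[OF k']] by (simp add: P_le_def)
  also have "\<dots> =
      (\<Sum>p<num_indices n 0 k. if ?p = p then W (colex_inv n 0 k p @ drop k xs) else 0)"
    by (intro sum.cong) (simp_all add: row)
  also have "\<dots> = W xs"
    using tk by (simp add: colex_less colex_inv_colex)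
  finally show ?thesis .
qed

text \<open>The matrix acting from the right is the transpose of an oblique projector of the same
  shape as \<open>P_le_mat\<close>, so its selected columns are unit columns.\<close>

lemma P_gt_interpolation:
  assumes k: "k \<in> {1..d - 1}" and xs: "xs \<in> multi_indices n 0 d" and mem: "drop k xs \<in> Igt k"
  shows "P_gt d n r V Igt k W xs = W xs"
proof -
  let ?p = "colex n k (drop k xs)"
  have "k \<le> d"
    using k by auto
  have dk: "drop k xs \<in> multi_indices n k d"
    using take_drop_multi_indices(2)[OF xs \<open>k \<le> d\<close>] .
  have inv: "invertible_mat (transpose_mat (X_gt d n Igt k) * V_gt d n r V k)"
    using projectors k by (simp add: define_interpolatory_projectors_def)
  let ?B = "inv_mat (transpose_mat (X_gt d n Igt k) * V_gt d n r V k)"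
  have X: "X_gt d n Igt k \<in> carrier_mat (num_indices n k d) (r k)"
    using column_selection_carrier[OF colex_Igt(1)[OF k]] colex_Igt(2)[OF k]
    by (simp add: X_gt_def)
  have V: "V_gt d n r V k \<in> carrier_mat (num_indices n k d) (r k)"
    by (simp add: V_gt_def)
  have B: "?B \<in> carrier_mat (r k) (r k)"
    using inv_mat_right(1)[OF inv] X V by simp
  have X': "transpose_mat (X_gt d n Igt k) \<in> carrier_mat (r k) (num_indices n k d)"
    and B': "transpose_mat ?B \<in> carrier_mat (r k) (r k)"
    and V': "transpose_mat (V_gt d n r V k) \<in> carrier_mat (r k) (num_indices n k d)"
    using X B V by simp_all
  have P: "P_gt_mat d n r V Igt k =
      transpose_mat (V_gt d n r V k * ?B * transpose_mat (X_gt d n Igt k))"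
    unfolding P_gt_mat_def
      transpose_mult[OF mult_carrier_mat[OF V B] X'] transpose_mult[OF V B]
      transpose_transpose
    by (rule assoc_mult_mat[OF X B' V'])
  have row: "P_gt_mat d n r V Igt k $$ (q, ?p) = (if ?p = q then 1 else 0)"
    if "q < num_indices n k d" for q
  proof -
    have "(V_gt d n r V k * ?B * transpose_mat (X_gt d n Igt k)) $$ (?p, q) = (if ?p = q then 1 else 0)"
      by (rule oblique_projector_row[OF colex_Igt(1)[OF k] _ X_gt_def inv])
        (use that mem colex_Igt(2)[OF k] V in simp_all)
    then show ?thesis
      unfolding P using that dk \<open>k \<le> d\<close> X V by (simp add: colex_less)
  qed
  have "P_gt d n r V Igt k W xs =
      (\<Sum>q<num_indices n k d.
        W (take k xs @ colex_inv n k d q) * P_gt_mat d n r V Igt k $$ (q, ?p))"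
    using \<open>k \<le> d\<close> Ten_right_mult[OF _ xs P_gt_mat_carrier[OF k]] by (simp add: P_gt_def)
  also have "\<dots> =
      (\<Sum>q<num_indices n k d. if ?p = q then W (take k xs @ colex_inv n k d q) else 0)"
    by (intro sum.cong) (simp_all add: row)
  also have "\<dots> = W xs"
    using dk \<open>k \<le> d\<close> by (simp add: colex_less colex_inv_colex)
  finally show ?thesis .
qed

text \<open>\<open>P_le\<close> at level \<open>m\<close> replaces the first \<open>m\<close>
  indices. As \<open>m \<le> k\<close>, the tail after position \<open>k\<close> stays in
  \<open>Igt k\<close>, so \<open>P_gt\<close> interpolates at every entry that is summed.\<close>

lemma P_le_P_gt:
  assumes k: "k \<in> {1..d - 1}" and m: "m \<le> k" and xs: "xs \<in> multi_indices n 0 d"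
    and mem: "drop k xs \<in> Igt k"
  shows "P_le d n r U Ile m (P_gt d n r V Igt k W) xs = P_le d n r U Ile m W xs"
proof (rule P_le_cong)
  show "m < d"
    using k m by auto
  fix ys assume ys: "ys \<in> multi_indices n 0 m"
  have "drop k (ys @ drop m xs) = drop k xs"
    using ys m by (simp add: multi_indices_def)
  moreover have "ys @ drop m xs \<in> multi_indices n 0 d"
    using append_multi_indices[OF _ _ ys take_drop_multi_indices(2)[OF xs]] k m by auto
  ultimately show "P_gt d n r V Igt k W (ys @ drop m xs) = W (ys @ drop m xs)"
    using P_gt_interpolation[OF k] mem by simp
qed (rule xs)

section \<open>Consequences of nestedness across several levels\<close>

text \<open>Each nesting step removes the last index; the list shrinks along the induction and is
  therefore generalized.\<close>

lemma nested_take: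
  assumes "k \<le> m" "m < d" "is \<in> Ile m"
  shows "take k is \<in> Ile k"
  using assms
proof (induction m arbitrary: "is" rule: dec_induct)
  case base
  then show ?case
    using length_Ile by simp
next
  case (step m)
  then have m: "Suc m \<in> {1..d - 1}"
    by auto
  then obtain js i where js: "is = js @ [i]" "js \<in> Ile m"
    using nested step.prems unfolding nested_def by fastforce
  have "length is = Suc m"
    using length_Ile step.prems by simp
  then show ?case
    using step js by simp
qed

text \<open>Each nesting step removes the first index. The list stays fixed and the induction runs
  over the target level \<open>k\<close>, starting at \<open>m \<ge> 1\<close> because
  \<open>nested\<close> constrains \<open>Igt\<close> only from level 1 on.\<close>

lemma nested_drop:
  assumes "1 \<le> m" "m \<le> k" "k \<le> d" "is \<in> Igt m"
  shows "drop (k - m) is \<in> Igt k"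
  using assms(2,3)
proof (induction k rule: dec_induct)
  case base
  then show ?case
    using assms(4) by simp
next
  case (step k)
  then have "k \<in> {1..d - 1}" "drop (k - m) is \<in> Igt k"
    using assms(1) by auto
  then obtain i js where "drop (k - m) is = i # js" "js \<in> Igt (Suc k)"
    using nested unfolding nested_def by fastforce
  then show ?case
    using step(1) by (simp add: Suc_diff_le drop_Suc flip: tl_drop)
qed

end

section \<open>The cross interpolation property\<close>

theorem theorem4p1:
  fixes d :: nat and n r :: "nat \<Rightarrow> nat"
    and Y :: "nat list \<Rightarrow> real"
    and U V :: cores and S :: "nat \<Rightarrow> real mat"
    and Ile Igt :: "nat \<Rightarrow> nat list set"
  assumes "d \<ge> 2"
    and "Y \<in> tt_manifold d n r"
    and "orthogonal_decompositions d n r Y U S V"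
    and "index_sets d n r Ile Igt"
    and "nested d n Ile Igt"
    and "define_interpolatory_projectors d n r U V Ile Igt"
  shows "\<forall>Z \<in> tensors d n. \<forall>j \<in> {1..d}. \<forall>i < n j. \<forall>is \<in> Ile (j - 1). \<forall>js \<in> Igt j.
           tangent_projector d n r U V Ile Igt Z (is @ [i] @ js) = Z (is @ [i] @ js)"
proof (intro ballI allI impI)
  fix Z j i "is" js
  assume j: "j \<in> {1..d}" and i: "i < n j" and "is": "is \<in> Ile (j - 1)" and js: "js \<in> Igt j"
  interpret interpolatory_projectors d n r U V Ile Igt
    using assms(4,5,6) by unfold_locales
  define xs where "xs = is @ [i] @ js"
  have isM: "is \<in> multi_indices n 0 (j - 1)" and jsM: "js \<in> multi_indices n j d"
    using subsetD[OF Ile_subset[of "j - 1"] "is"] Igt_subset[of j] j js by auto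
  have lis: "length is = j - 1"
    using isM by (simp add: multi_indices_def)
  have "[i] @ js \<in> multi_indices n (j - 1) d"
    using Cons_multi_indices[of "j - 1" d i js n] i j jsM by auto
  then have xs: "xs \<in> multi_indices n 0 d"
    unfolding xs_def using append_multi_indices[OF _ _ isM] j by auto
  have left: "take k xs \<in> Ile k" if "k < j" for k
  proof -
    have "k \<le> j - 1" "j - 1 < d"
      using that j by auto
    then show ?thesis
      using nested_take[OF _ _ "is"] lis by (simp add: xs_def)
  qed
  have right: "drop k xs \<in> Igt k" if "j \<le> k" "k \<le> d" for k
  proof -
    \<comment> \<open>The part before \<open>js\<close> has length \<open>(j - 1) + 1 = j\<close>,
      so dropping \<open>k \<ge> j\<close> entries removes all of it.\<close>
    have "drop k xs = drop (k - j) js"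
      using that j lis by (cases j) (auto simp: xs_def drop_Cons' intro!: arg_cong2[where f = drop])
    then show ?thesis
      using nested_drop[OF _ that js] j by simp
  qed
  let ?L = "\<lambda>k. P_le d n r U Ile k" and ?R = "\<lambda>k. P_gt d n r V Igt k"
  have summand: "?L (k - 1) (?R k Z) xs - ?L k (?R k Z) xs = ?L (k - 1) Z xs - ?L k Z xs"
    if k: "k \<in> {1..d - 1}" for k
  proof (cases "k < j")
    \<comment> \<open>Both \<open>k - 1\<close> and \<open>k\<close> lie below \<open>j\<close>, so
      both sides are differences of equal values.\<close>
    case True
    moreover have "k < d" "k - 1 < d"
      using k by auto
    ultimately show ?thesis
      using P_le_interpolation[OF _ xs left] by simp
  next
    case False
    then have "drop k xs \<in> Igt k"
      using right[of k] k by auto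
    \<comment> \<open>\<open>P_gt\<close> is dropped twice, under \<open>P_le\<close> at levels
      \<open>k - 1\<close> and \<open>k\<close>.\<close>
    then show ?thesis
      using P_le_P_gt[OF k _ xs] by simp
  qed
  have telescope: "(\<Sum>k = 1..m. ?L (k - 1) Z xs - ?L k Z xs) = ?L 0 Z xs - ?L m Z xs" for m
    by (induction m) auto
  have "tangent_projector d n r U V Ile Igt Z xs =
      (\<Sum>k = 1..d - 1. ?L (k - 1) Z xs - ?L k Z xs) + ?L (d - 1) Z xs"
    unfolding tangent_projector_def by (intro arg_cong2[where f = "(+)"] sum.cong refl summand)
  \<comment> \<open>The telescoped sum starts at \<open>?L 0\<close>, the identity, and its end term
    cancels against \<open>?L (d - 1)\<close>.\<close>
  also have "\<dots> = Z xs"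
    unfolding telescope by (simp add: P_le_def)
  finally show "tangent_projector d n r U V Ile Igt Z (is @ [i] @ js) = Z (is @ [i] @ js)"
    by (simp add: xs_def)
qed

end
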